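(* Let $\mathcal{I}_{\mathrm{tree}}=\{\, i(T) : T \text{ is a tree}\,\}\subseteq\mathbb{N}$ be the set of positive integers that occur as the number of independent sets of some tree, and let $\tau = 1+\sqrt{2}$. Then the lower growth exponent of $\mathcal{I}_{\mathrm{tree}}$ satisfies $$\underline{\mathrm{Exp}}(\mathcal{I}_{\mathrm{tree}}) \;=\; \liminf_{N\to\infty}\frac{\log\left(|\mathcal{I}_{\mathrm{tree}}\cap\{1,\ldots,N\}|\right)}{\log N}\;\ge\;\frac{\log_{\tau}2}{4}\;\approx\;0.1966.$$ Equivalently, $$|\mathcal{I}_{\mathrm{tree}}\cap\{1,\ldots,N\}|\;\gg\; N^{\frac{\log_{\tau}2}{4}-o(1)}.$$
   Context: Graphs are finite and simple. An independent set of a graph is a set of vertices no two of which are adjacent (the empty set counts as independent). For a graph $G$, $i(G)$ denotes the number of independent sets of $G$. $\mathbb{N}=\{1,2,3,\ldots\}$. For $S\subseteq\mathbb{N}$, the lower growth exponent of $S$ is $\underline{\mathrm{Exp}}(S)=\liminf_{N\to\infty}\frac{\log(|S\cap\{1,\ldots,N\}|)}{\log N}$. Notation: $f(N)\ll g(N)$ (equivalently $g(N)\gg f(N)$) means there is a constant $C>0$ such that $f(N)\le C g(N)$ for all sufficiently large $N$. $\log_\tau$ is the logarithm to base $\tau$, and $o(1)$ denotes a quantity tending to $0$ as $N\to\infty$. *)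

theory Defs
  imports Complex_Main "HOL-Library.Extended_Real" "Graph_Theory.Graph_Theory"
begin

text \<open>
  A finite simple graph is a \<^locale>\<open>pair_graph\<close>: a finite, loop-free, symmetric digraph whose
  arcs are pairs of vertices, so that an edge is represented by its two opposite arcs.
\<close>

text \<open>
  The predicates \<open>forest\<close> and \<open>tree\<close> of the graph library forbid directed cycles. In a symmetric
  digraph they are unsuitable, since the walk \<open>a, b, a\<close> along a single edge is then a cycle of
  length 2. A cycle of the undirected graph is a directed cycle of length at least 3.
\<close>

definition undirected_cycle :: "'a pair_pre_digraph \<Rightarrow> ('a \<times> 'a) list \<Rightarrow> bool" where
  "undirected_cycle G p \<longleftrightarrow> pre_digraph.cycle (with_proj G) p \<and> length p \<ge> 3"

text \<open>\<^const>\<open>Digraph_Component.connected\<close> includes that there is at least one vertex.\<close>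

definition is_tree :: "'a pair_pre_digraph \<Rightarrow> bool" where
  "is_tree G \<longleftrightarrow> pair_graph G \<and> Digraph_Component.connected (with_proj G) \<and>
     \<not> (\<exists>p. undirected_cycle G p)"

definition independent_set :: "'a pair_pre_digraph \<Rightarrow> 'a set \<Rightarrow> bool" where
  "independent_set G S \<longleftrightarrow> S \<subseteq> pverts G \<and> (\<forall>u\<in>S. \<forall>v\<in>S. (u, v) \<notin> parcs G)"

definition num_independent_sets :: "'a pair_pre_digraph \<Rightarrow> nat" where
  "num_independent_sets G = card {S. independent_set G S}"

text \<open>
  Natural numbers as vertices suffice, as every finite graph is isomorphic to one of this kind.
\<close>

definition I_tree :: "nat set" where
  "I_tree = {num_independent_sets T | T :: nat pair_pre_digraph. is_tree T}"

text \<open>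
  The terms with \<open>S \<inter> {1..N} = {}\<close>, where HOL sets \<open>ln 0 = 0\<close>, do not affect the limit inferior
  as soon as \<open>S\<close> contains a positive number.
\<close>

definition lower_growth_exponent :: "nat set \<Rightarrow> ereal" where
  "lower_growth_exponent S =
     liminf (\<lambda>N. ereal (ln (real (card (S \<inter> {1..N}))) / ln (real N)))"

end

theory Submission
  imports Defs
begin

text \<open>
  The bound comes from caterpillars, and it holds with the exponent \<open>1/4\<close> in place of
  \<open>log\<^sub>\<tau> 2 / 4 = 0.1966\<dots>\<close>.

  Describe a tree with root \<open>r\<close> by the pair \<open>(a, b)\<close>, where \<open>a\<close> counts the independent sets
  avoiding \<open>r\<close> and \<open>b\<close> those containing \<open>r\<close>. Attaching a new root to \<open>r\<close> turns \<open>(a, b)\<close> into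
  \<open>(a + b, a)\<close>; hanging in addition a leaf on the new root gives \<open>(2 (a + b), a)\<close>. These two
  moves are a binary choice at each spine vertex of a caterpillar, so \<open>k\<close> moves starting from
  the one-vertex tree \<open>(1, 1)\<close> correspond to the binary words of length \<open>k\<close>. In terms of the
  ratio \<open>x = b / a \<in> (0, 1]\<close> the moves are \<open>x \<mapsto> 1 / (1 + x)\<close>, with values in \<open>[1/2, 1)\<close>, and
  \<open>x \<mapsto> 1 / (2 (1 + x))\<close>, with values in \<open>[1/4, 1/2)\<close>. The two ranges are disjoint, so the last
  move can be read off the pair, and the \<open>2^k\<close> words give \<open>2^k\<close> different pairs.

  A pair is two numbers, whereas the set to be counted consists of single numbers. If \<open>(a, b)\<close>
  belongs to a rooted tree, then \<open>a + b\<close> is the number of independent sets of this tree, and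
  \<open>2 a + b\<close> is that of the tree with one more leaf at the root. Since \<open>(a, b)\<close> is determined by
  \<open>(2 a + b, a + b)\<close>, there are \<open>2^k\<close> different pairs of numbers in \<open>I_tree\<close>. All of them are at
  most \<open>4^(k + 1)\<close>, so \<open>I_tree\<close> has at least \<open>2^(k / 2)\<close> elements up to \<open>4^(k + 1)\<close>, which is of
  order \<open>N powr (1/4)\<close> for \<open>N = 4^(k + 1)\<close>.
\<close>

section \<open>Trees and their leaves\<close>

lemma connected_iff_rtrancl:
  assumes "pair_graph G"
  shows "Digraph_Component.connected (with_proj G) \<longleftrightarrow>
    pverts G \<noteq> {} \<and> (\<forall>u\<in>pverts G. \<forall>v\<in>pverts G. (u, v) \<in> (parcs G)\<^sup>*)"
proof -
  interpret G: pair_graph G by fact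
  interpret S: pair_wf_digraph "mk_symmetric (with_proj G)" ..
  have "parcs (mk_symmetric (with_proj G)) = parcs G"
    using G.adj_mk_symmetric_eq[OF G.sym_arcs] by simp
  then show ?thesis
    by (auto simp: connected_def strongly_connected_def S.reachable_conv')
qed

lemma pcas_vertices:
  "pcas u p v \<Longrightarrow> map fst p @ [v] = u # map snd p"
  by (induction p arbitrary: u) auto

lemma tl_pawalk_verts: "pcas u p v \<Longrightarrow> tl (pawalk_verts u p) = map snd p"
proof (induction p arbitrary: u)
  case (Cons e p)
  then show ?case by (cases p) auto
qed simp

lemma undirected_cycle_iff:
  assumes "pair_wf_digraph G"
  shows "undirected_cycle G p \<longleftrightarrow>
    set p \<subseteq> parcs G \<and> (\<exists>u. pcas u p u) \<and> distinct (map snd p) \<and> 3 \<le> length p"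
proof -
  interpret G: pair_wf_digraph G by fact
  have start: "u \<in> pverts G" if "set p \<subseteq> parcs G" "pcas u p u" "p \<noteq> []" for u
  proof (cases p)
    case (Cons e es)
    then show ?thesis using that G.arc_fst_in_verts by auto
  qed (use that in simp)
  have "G.cycle p \<longleftrightarrow> (\<exists>u. u \<in> pverts G \<and> set p \<subseteq> parcs G \<and> pcas u p u
      \<and> distinct (map snd p) \<and> p \<noteq> [])"
    unfolding G.cycle_def G.awalk_def by (metis tl_pawalk_verts)
  then show ?thesis
    unfolding undirected_cycle_def using start by fastforce
qed

text \<open>
  Every vertex of an undirected cycle has two different neighbours on the cycle. If a vertex has
  only one neighbour \<open>u\<close>, then the cycle would leave it to the same vertex \<open>u\<close> from which it
  came, and so would pass through \<open>u\<close> twice.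
\<close>

lemma cycle_avoids_leaf:
  assumes walk: "pcas w p w" and dist: "distinct (map snd p)" and len: "3 \<le> length p"
    and into: "\<And>x. (x, v) \<in> set p \<Longrightarrow> x = u" and out: "\<And>x. (v, x) \<in> set p \<Longrightarrow> x = u"
  shows "v \<notin> fst ` set p \<and> v \<notin> snd ` set p"
proof -
  let ?n = "length p"
  note vs = pcas_vertices[OF walk]
  have "mset (map fst p @ [w]) = mset (w # map snd p)"
    by (simp only: vs)
  then have mset: "mset (map fst p) = mset (map snd p)" by simp
  then have dist_fst: "distinct (map fst p)"
    using dist by (metis mset_eq_imp_distinct_iff)
  have set_eq: "fst ` set p = snd ` set p"
    using mset_eq_setD[OF mset] by simp
  have succ: "fst (p ! (Suc i mod ?n)) = snd (p ! i)" if i: "i < ?n" for i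
  proof (cases "Suc i = ?n")
    case True
    have "hd (map fst p @ [w]) = w" unfolding vs by simp
    then have "fst (p ! 0) = w" using len by (cases p) auto
    moreover have "(map fst p @ [w]) ! Suc i = snd (p ! i)" unfolding vs using i by simp
    ultimately show ?thesis
      using True by (simp add: nth_append)
  next
    case False
    have "(map fst p @ [w]) ! Suc i = snd (p ! i)"
      unfolding vs using i by simp
    with False i show ?thesis by (simp add: nth_append)
  qed
  have False if "v \<in> snd ` set p"
  proof -
    from that obtain i where i: "i < ?n" and pi: "snd (p ! i) = v"
      by (auto simp: in_set_conv_nth)
    define j where "j = Suc i mod ?n"
    define l where "l = Suc j mod ?n"
    have j: "j < ?n" and l: "l < ?n"
      using i mod_less_divisor[of ?n] by (auto simp only: j_def l_def)
    have "fst (p ! i) = u"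
      using into[of "fst (p ! i)"] i pi by (metis nth_mem prod.collapse)
    moreover have "fst (p ! j) = v" using succ[OF i] pi by (simp add: j_def)
    then have "snd (p ! j) = u"
      using out[of "snd (p ! j)"] j by (metis nth_mem prod.collapse)
    then have "fst (p ! l) = u" using succ[OF j] by (simp add: l_def)
    ultimately have "l = i"
      using dist_fst i l by (simp add: distinct_conv_nth) metis
    then show False
      using i len unfolding l_def j_def by (auto simp: mod_Suc split: if_splits)
  qed
  with set_eq show ?thesis by blast
qed

definition add_leaf :: "'a pair_pre_digraph \<Rightarrow> 'a \<Rightarrow> 'a \<Rightarrow> 'a pair_pre_digraph" where
  "add_leaf G u v = \<lparr>pverts = insert v (pverts G), parcs = parcs G \<union> {(u, v), (v, u)}\<rparr>"

lemma add_leaf_simps [simp]: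
  "pverts (add_leaf G u v) = insert v (pverts G)"
  "parcs (add_leaf G u v) = parcs G \<union> {(u, v), (v, u)}"
  by (simp_all add: add_leaf_def)

lemma pair_graph_add_leaf:
  assumes "pair_graph G" "u \<in> pverts G" "v \<notin> pverts G"
  shows "pair_graph (add_leaf G u v)"
proof -
  interpret G: pair_graph G by fact
  show ?thesis
    using assms(2,3) G.arcs_symmetric
    by unfold_locales
      (auto simp: symmetric_def sym_def G.no_loops' dest: G.in_arcsD1 G.in_arcsD2)
qed

lemma is_tree_add_leaf:
  assumes tree: "is_tree G" and u: "u \<in> pverts G" and v: "v \<notin> pverts G"
  shows "is_tree (add_leaf G u v)"
proof -
  let ?H = "add_leaf G u v"
  have graph: "pair_graph G" and conn: "Digraph_Component.connected (with_proj G)"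
    and acyclic: "\<And>p. \<not> undirected_cycle G p"
    using tree by (auto simp: is_tree_def)
  interpret G: pair_graph G by fact
  have H: "pair_graph ?H" using pair_graph_add_leaf[OF graph u v] .
  interpret H: pair_graph ?H by fact
  have reach: "(x, y) \<in> (parcs ?H)\<^sup>*" if "x \<in> pverts G" "y \<in> pverts G" for x y
    using conn that rtrancl_mono[of "parcs G" "parcs ?H"]
    unfolding connected_iff_rtrancl[OF graph] by auto
  have to_u: "(x, u) \<in> (parcs ?H)\<^sup>*" and from_u: "(u, x) \<in> (parcs ?H)\<^sup>*"
    if "x \<in> pverts ?H" for x
    using that reach u by auto
  have "Digraph_Component.connected (with_proj ?H)"
    unfolding connected_iff_rtrancl[OF H] using to_u from_u by (auto intro: rtrancl_trans)
  moreover have "\<not> undirected_cycle ?H p" for p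
  proof
    assume "undirected_cycle ?H p"
    then obtain w where p: "set p \<subseteq> parcs ?H" "pcas w p w" "distinct (map snd p)" "3 \<le> length p"
      using undirected_cycle_iff[OF H.pair_wf_digraph] by blast
    have "v \<notin> fst ` set p \<and> v \<notin> snd ` set p"
      by (rule cycle_avoids_leaf[OF p(2-4), of v u])
        (use p(1) v G.in_arcsD1 G.in_arcsD2 in auto)
    then have "set p \<subseteq> parcs G" using p(1) by force
    then have "undirected_cycle G p"
      using p undirected_cycle_iff[OF G.pair_wf_digraph] by blast
    with acyclic show False by blast
  qed
  ultimately show ?thesis using H by (simp add: is_tree_def)
qed

lemma is_tree_singleton: "is_tree \<lparr>pverts = {r}, parcs = {}\<rparr>"
proof -
  have G: "pair_graph \<lparr>pverts = {r}, parcs = {}\<rparr>"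
    by unfold_locales (auto simp: symmetric_def sym_def)
  then interpret G: pair_graph "\<lparr>pverts = {r}, parcs = {}\<rparr>" .
  show ?thesis
    using G undirected_cycle_iff[OF G.pair_wf_digraph]
    by (auto simp: is_tree_def connected_iff_rtrancl)
qed

section \<open>Independent sets of rooted trees\<close>

lemma independent_set_add_leaf:
  assumes "pair_wf_digraph G" "u \<in> pverts G" "v \<notin> pverts G"
  shows "independent_set (add_leaf G u v) S \<longleftrightarrow>
    (if v \<in> S then u \<notin> S \<and> independent_set G (S - {v}) else independent_set G S)"
proof -
  interpret G: pair_wf_digraph G by fact
  show ?thesis
    using assms(2,3) unfolding independent_set_def
    by (auto dest: G.in_arcsD1 G.in_arcsD2)
qed

definition sets_avoiding :: "'a pair_pre_digraph \<Rightarrow> 'a \<Rightarrow> 'a set set" where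
  "sets_avoiding G r = {S. independent_set G S \<and> r \<notin> S}"

definition sets_through :: "'a pair_pre_digraph \<Rightarrow> 'a \<Rightarrow> 'a set set" where
  "sets_through G r = {S. independent_set G S \<and> r \<in> S}"

lemma finite_independent_sets:
  assumes "finite (pverts G)"
  shows "finite {S. independent_set G S}"
  by (rule finite_subset[of _ "Pow (pverts G)"]) (use assms in \<open>auto simp: independent_set_def\<close>)

lemma num_independent_sets_split:
  assumes "finite (pverts G)"
  shows "num_independent_sets G = card (sets_avoiding G r) + card (sets_through G r)"
proof -
  have "{S. independent_set G S} = sets_avoiding G r \<union> sets_through G r"
    by (auto simp: sets_avoiding_def sets_through_def)
  moreover have "finite (sets_avoiding G r)" "finite (sets_through G r)"
    using finite_independent_sets[OF assms]
    by (auto simp: sets_avoiding_def sets_through_def elim: rev_finite_subset)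
  moreover have "sets_avoiding G r \<inter> sets_through G r = {}"
    by (auto simp: sets_avoiding_def sets_through_def)
  ultimately show ?thesis
    by (simp add: num_independent_sets_def card_Un_disjoint)
qed

lemma card_sets_add_leaf:
  assumes G: "pair_wf_digraph G" "finite (pverts G)" and u: "u \<in> pverts G" and v: "v \<notin> pverts G"
  shows "card (sets_avoiding (add_leaf G u v) v) = num_independent_sets G"
    and "card (sets_through (add_leaf G u v) v) = card (sets_avoiding G u)"
    and "card (sets_avoiding (add_leaf G u v) u) = 2 * card (sets_avoiding G u)"
    and "card (sets_through (add_leaf G u v) u) = card (sets_through G u)"
proof -
  let ?H = "add_leaf G u v"
  note ind = independent_set_add_leaf[OF G(1) u v]
  have fresh: "v \<notin> S" if "independent_set G S" for S
    using that v by (auto simp: independent_set_def)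
  have "u \<noteq> v" using u v by auto
  have fin: "finite (sets_avoiding G u)"
    using finite_independent_sets[OF G(2)]
    by (auto simp: sets_avoiding_def elim: rev_finite_subset)
  have inj: "inj_on (insert v) (sets_avoiding G u)"
    by (rule inj_onI) (use fresh in \<open>auto simp: sets_avoiding_def insert_ident\<close>)
  have "sets_avoiding ?H v = {S. independent_set G S}"
    using fresh by (auto simp: sets_avoiding_def ind)
  then show "card (sets_avoiding ?H v) = num_independent_sets G"
    by (simp add: num_independent_sets_def)
  have through: "sets_through ?H v = insert v ` sets_avoiding G u"
  proof (intro set_eqI iffI)
    fix S assume "S \<in> sets_through ?H v"
    then have "S - {v} \<in> sets_avoiding G u" "S = insert v (S - {v})"
      by (auto simp: sets_through_def sets_avoiding_def ind)
    then show "S \<in> insert v ` sets_avoiding G u" by blast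
  next
    fix S assume "S \<in> insert v ` sets_avoiding G u"
    then show "S \<in> sets_through ?H v"
      using fresh \<open>u \<noteq> v\<close> by (auto simp: sets_through_def sets_avoiding_def ind)
  qed
  then show "card (sets_through ?H v) = card (sets_avoiding G u)"
    by (simp add: card_image[OF inj])
  have "sets_avoiding ?H u = sets_avoiding G u \<union> insert v ` sets_avoiding G u"
    unfolding through[symmetric] using fresh
    by (auto simp: sets_through_def sets_avoiding_def ind)
  moreover have "sets_avoiding G u \<inter> insert v ` sets_avoiding G u = {}"
    using fresh by (auto simp: sets_avoiding_def)
  ultimately show "card (sets_avoiding ?H u) = 2 * card (sets_avoiding G u)"
    using fin by (simp add: card_Un_disjoint card_image[OF inj])
  have "sets_through ?H u = sets_through G u"
    using fresh by (auto simp: sets_through_def ind)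
  then show "card (sets_through ?H u) = card (sets_through G u)" by simp
qed

definition rooted_tree_counts :: "nat \<Rightarrow> nat \<Rightarrow> bool" where
  "rooted_tree_counts a b \<longleftrightarrow>
    (\<exists>(T :: nat pair_pre_digraph) r. is_tree T \<and> r \<in> pverts T \<and>
      card (sets_avoiding T r) = a \<and> card (sets_through T r) = b)"

lemma rooted_tree_counts_sum_in_I_tree:
  assumes "rooted_tree_counts a b"
  shows "a + b \<in> I_tree"
proof -
  obtain T :: "nat pair_pre_digraph" and r where T: "is_tree T"
    "card (sets_avoiding T r) = a" "card (sets_through T r) = b"
    using assms unfolding rooted_tree_counts_def by blast
  interpret pair_graph T using T(1) by (simp add: is_tree_def)
  show ?thesis
    unfolding I_tree_def using T num_independent_sets_split[OF pair_finite_verts, of r]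
    by (intro CollectI exI[of _ T]) simp
qed

lemma rooted_tree_counts_singleton: "rooted_tree_counts 1 1"
proof -
  let ?G = "\<lparr>pverts = {0::nat}, parcs = {}\<rparr>"
  have "sets_avoiding ?G 0 = {{}}" "sets_through ?G 0 = {{0}}"
    by (auto simp: sets_avoiding_def sets_through_def independent_set_def)
  then have "card (sets_avoiding ?G 0) = 1" "card (sets_through ?G 0) = 1" by simp_all
  then show ?thesis
    unfolding rooted_tree_counts_def using is_tree_singleton[of "0::nat"]
    by (intro exI[of _ ?G] exI[of _ 0]) simp
qed

text \<open>
  The two counts come from one and the same graph: the old tree with a leaf attached to its root,
  rooted either at this leaf or at the old root.
\<close>

lemma rooted_tree_counts_leaf:
  assumes "rooted_tree_counts a b"
  shows rooted_tree_counts_new_root: "rooted_tree_counts (a + b) a"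
    and rooted_tree_counts_old_root: "rooted_tree_counts (2 * a) b"
proof -
  obtain T :: "nat pair_pre_digraph" and r where T: "is_tree T" and r: "r \<in> pverts T"
    and ab: "card (sets_avoiding T r) = a" "card (sets_through T r) = b"
    using assms unfolding rooted_tree_counts_def by blast
  interpret pair_graph T using T by (simp add: is_tree_def)
  obtain v where v: "v \<notin> pverts T"
    using pair_finite_verts ex_new_if_finite infinite_UNIV_nat by blast
  note cards = card_sets_add_leaf[OF pair_wf_digraph pair_finite_verts r v]
    and tree = is_tree_add_leaf[OF T r v]
  show "rooted_tree_counts (a + b) a"
    unfolding rooted_tree_counts_def
    using tree cards ab num_independent_sets_split[OF pair_finite_verts, of r]
    by (intro exI[of _ "add_leaf T r v"] exI[of _ v]) simp
  show "rooted_tree_counts (2 * a) b"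
    unfolding rooted_tree_counts_def using tree cards ab r
    by (intro exI[of _ "add_leaf T r v"] exI[of _ r]) simp
qed

section \<open>Caterpillars\<close>

text \<open>
  The word lists the moves, the most recent one first. The value is the pair of counts of the
  caterpillar that they build from the one-vertex tree, rooted at the newest spine vertex; a
  letter \<open>True\<close> stands for a spine vertex with a leaf hanging on it.
\<close>

fun caterpillar :: "bool list \<Rightarrow> nat \<times> nat" where
  "caterpillar [] = (1, 1)"
| "caterpillar (leaf # w) =
    (case caterpillar w of (a, b) \<Rightarrow> (if leaf then 2 * (a + b) else a + b, a))"

lemma rooted_tree_counts_caterpillar:
  "caterpillar w = (a, b) \<Longrightarrow> rooted_tree_counts a b"
proof (induction w arbitrary: a b)
  case Nil
  then show ?case using rooted_tree_counts_singleton by auto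
next
  case (Cons leaf w)
  obtain c d where cd: "caterpillar w = (c, d)" by fastforce
  have "rooted_tree_counts (c + d) c"
    using Cons.IH[OF cd] by (rule rooted_tree_counts_new_root)
  moreover from this have "rooted_tree_counts (2 * (c + d)) c"
    by (rule rooted_tree_counts_old_root)
  ultimately show ?case using Cons.prems cd by (auto split: if_splits)
qed

text \<open>
  The factor 4 per move is a crude bound, as \<open>2 (2 (c + d)) + c \<le> 4 (2 c + d)\<close>. It is good enough:
  a binary choice per factor 4 gives \<open>M powr (1/2)\<close> pairs up to \<open>M\<close>, hence \<open>M powr (1/4)\<close> numbers.
\<close>

lemma caterpillar_bounds:
  "caterpillar w = (a, b) \<Longrightarrow> 0 < b \<and> b \<le> a \<and> 2 * a + b \<le> 4 ^ Suc (length w)"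
proof (induction w arbitrary: a b)
  case (Cons leaf w)
  obtain c d where cd: "caterpillar w = (c, d)" by fastforce
  show ?case using Cons.IH[OF cd] Cons.prems cd by (auto split: if_splits)
qed auto

text \<open>
  Let \<open>(c, d)\<close> be the counts before the last move, so that \<open>b = c\<close> and \<open>0 < d \<le> c\<close>. Without a leaf,
  \<open>a = c + d \<le> 2 b\<close>; with a leaf, \<open>a = 2 (c + d) > 2 b\<close>. So the last move can be decoded.
\<close>

lemma caterpillar_leaf_iff:
  assumes "caterpillar (leaf # w) = (a, b)"
  shows "leaf \<longleftrightarrow> 2 * b < a"
proof -
  obtain c d where cd: "caterpillar w = (c, d)" by fastforce
  show ?thesis using caterpillar_bounds[OF cd] assms cd by (auto split: if_splits)
qed

lemma caterpillar_inj:
  "length w = length w' \<Longrightarrow> caterpillar w = caterpillar w' \<Longrightarrow> w = w'"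
proof (induction w w' rule: list_induct2)
  case (Cons x w y w')
  have "x = y"
    using Cons.prems caterpillar_leaf_iff[of x w] caterpillar_leaf_iff[of y w']
    by (metis surj_pair)
  moreover from this have "caterpillar w = caterpillar w'"
    using Cons.prems by (auto split: prod.splits if_splits)
  ultimately show ?case using Cons.IH by simp
qed simp

section \<open>Counting\<close>

text \<open>
  A caterpillar with counts \<open>(a, b)\<close> is sent to the point \<open>(2 a + b, a + b)\<close>. This embeds the words
  of length \<open>k\<close> into the square of \<open>I_tree \<inter> {1..4^(k + 1)}\<close>.
\<close>

lemma card_I_tree_power:
  "2 ^ k \<le> (card (I_tree \<inter> {1..4 ^ Suc k}))\<^sup>2"
proof -
  let ?I = "I_tree \<inter> {1..4 ^ Suc k}"
  let ?W = "{w :: bool list. set w \<subseteq> UNIV \<and> length w = k}"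
  define f :: "nat \<times> nat \<Rightarrow> nat \<times> nat" where "f = (\<lambda>(a, b). (2 * a + b, a + b))"
  have "inj f" by (auto simp: inj_def f_def)
  then have "inj_on (f \<circ> caterpillar) ?W"
    by (intro inj_onI caterpillar_inj) (auto dest: injD)
  moreover have "(f \<circ> caterpillar) ` ?W \<subseteq> ?I \<times> ?I"
  proof (clarsimp simp del: power_Suc)
    fix w x y assume w: "(x, y) = f (caterpillar w)" "k = length w"
    obtain a b where ab: "caterpillar w = (a, b)" by fastforce
    have tree: "rooted_tree_counts a b" using rooted_tree_counts_caterpillar[OF ab] .
    have "a + b \<in> I_tree" using rooted_tree_counts_sum_in_I_tree[OF tree] .
    moreover have "2 * a + b \<in> I_tree"
      using rooted_tree_counts_sum_in_I_tree[OF rooted_tree_counts_old_root[OF tree]] .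
    ultimately show "x \<in> I_tree \<and> Suc 0 \<le> x \<and> x \<le> 4 ^ Suc (length w) \<and>
        y \<in> I_tree \<and> Suc 0 \<le> y \<and> y \<le> 4 ^ Suc (length w)"
      using w ab caterpillar_bounds[OF ab] by (auto simp: f_def)
  qed
  ultimately have "card ?W \<le> card (?I \<times> ?I)"
    by (rule card_inj_on_le) simp
  moreover have "card ?W = 2 ^ k"
    by (subst card_lists_length_eq) simp_all
  ultimately show ?thesis
    by (simp add: card_cartesian_product power2_eq_square)
qed

lemma le_card_I_tree_power4:
  assumes "4 \<le> N"
  shows "N \<le> (2 * card (I_tree \<inter> {1..N})) ^ 4"
proof -
  obtain n where n: "4 ^ n \<le> N" "N < 4 ^ (n + 1)"
    using ex_power_ivl1[of 4 N] assms by auto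
  with assms have "n \<noteq> 0" by (intro notI) simp
  then obtain k where k: "n = Suc k" using not0_implies_Suc by blast
  let ?c = "card (I_tree \<inter> {1..N})"
  have "card (I_tree \<inter> {1..4 ^ Suc k}) \<le> ?c"
    using n(1) k by (intro card_mono) auto
  then have "2 ^ k \<le> ?c\<^sup>2"
    using card_I_tree_power[of k] by (meson order_trans power_mono zero_le)
  then have "(2 ^ k)\<^sup>2 \<le> (?c\<^sup>2)\<^sup>2"
    by (intro power_mono) auto
  then have "4 ^ k \<le> ?c ^ 4"
    by (simp add: power_mult[symmetric] mult.commute[of k] power_mult[of 2 2])
  then show ?thesis using n(2) k by (simp add: power_mult_distrib)
qed

section \<open>The constant\<close>

text \<open>
  The fractions \<open>81/103\<close> and \<open>70/89\<close> are convergents of the continued fraction of \<open>log\<^sub>\<tau> 2\<close>.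
  Comparing \<open>\<tau>^81\<close> with \<open>2^103\<close> and \<open>\<tau>^70\<close> with \<open>2^89\<close> reduces the numerical bounds to integer
  arithmetic, as the powers of \<open>\<tau>\<close> have the form \<open>p + q sqrt 2\<close>.
\<close>

lemma silver_ratio_power_double:
  assumes "(1 + sqrt 2) ^ n = p + q * sqrt 2"
  shows "(1 + sqrt 2) ^ (2 * n) = (p\<^sup>2 + 2 * q\<^sup>2) + (2 * p * q) * sqrt 2"
proof -
  have "(1 + sqrt 2) ^ (2 * n) = (p + q * sqrt 2)\<^sup>2"
    using assms by (simp add: power_mult mult.commute[of 2 n])
  then show ?thesis by (simp add: power2_sum power_mult_distrib algebra_simps)
qed

lemma silver_ratio_power_Suc:
  assumes "(1 + sqrt 2) ^ n = p + q * sqrt 2"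
  shows "(1 + sqrt 2) ^ (n + 1) = (p + 2 * q) + (p + q) * sqrt 2"
  using assms by (simp add: algebra_simps)

lemma log_silver_ratio_bounds:
  "81 / 103 < log (1 + sqrt 2) 2" "log (1 + sqrt 2) 2 < 70 / 89"
proof -
  have sqrt2: "1.4142 < sqrt 2" "sqrt 2 < 1.4143"
    by (rule real_less_rsqrt real_less_lsqrt; simp add: power2_eq_square)+
  have "1 < 1 + sqrt 2" by simp
  then have ln_pos: "0 < ln (1 + sqrt 2)" by (rule ln_gt_zero)
  note double = silver_ratio_power_double and one = silver_ratio_power_Suc
  have 2: "(1 + sqrt 2) ^ 2 = 3 + 2 * sqrt 2" by (simp add: power2_sum)
  note 4 = double[OF 2, simplified]
  note 5 = one[OF 4, simplified] note 10 = double[OF 5, simplified]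
  note 20 = double[OF 10, simplified] note 40 = double[OF 20, simplified]
  note 80 = double[OF 40, simplified] note 81 = one[OF 80, simplified]
  note 8 = double[OF 4, simplified] note 16 = double[OF 8, simplified]
  note 17 = one[OF 16, simplified] note 34 = double[OF 17, simplified]
  note 35 = one[OF 34, simplified] note 70 = double[OF 35, simplified]
  have "(1 + sqrt 2) ^ 81 < 2 ^ 103"
    unfolding 81 using sqrt2 by simp
  then have "ln ((1 + sqrt 2) ^ 81) < ln (2 ^ 103)"
    by (intro ln_less_cancel_iff[THEN iffD2]) (auto intro!: zero_less_power add_pos_pos)
  then have "81 * ln (1 + sqrt 2) < 103 * ln 2"
    using ln_realpow[of 2 103] by (simp add: ln_realpow add_pos_pos)
  then show "81 / 103 < log (1 + sqrt 2) 2"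
    using ln_pos by (simp add: log_def field_simps)
  have "2 ^ 89 < (1 + sqrt 2) ^ 70"
    unfolding 70 using sqrt2 by simp
  then have "ln (2 ^ 89) < ln ((1 + sqrt 2) ^ 70)"
    by (intro ln_less_cancel_iff[THEN iffD2]) (auto intro!: zero_less_power add_pos_pos)
  then have "89 * ln 2 < 70 * ln (1 + sqrt 2)"
    using ln_realpow[of 2 89] by (simp add: ln_realpow add_pos_pos)
  then show "log (1 + sqrt 2) 2 < 70 / 89"
    using ln_pos by (simp add: log_def field_simps)
qed

section \<open>The growth exponent\<close>

theorem theorem1p3:
  shows "lower_growth_exponent I_tree \<ge> ereal (log (1 + sqrt 2) 2 / 4)
    \<and> \<bar>log (1 + sqrt 2) 2 / 4 - 0.1966\<bar> < 0.00005
    \<and> (\<exists>\<epsilon> :: nat \<Rightarrow> real. \<epsilon> \<longlonglongrightarrow> 0 \<and>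
          (\<exists>C > 0. eventually (\<lambda>N. real N powr (log (1 + sqrt 2) 2 / 4 - \<epsilon> N)
             \<le> C * real (card (I_tree \<inter> {1..N}))) sequentially))"
proof (intro conjI)
  let ?\<alpha> = "log (1 + sqrt 2) 2 / 4" and ?c = "\<lambda>N. card (I_tree \<inter> {1..N})"
  have \<alpha>: "?\<alpha> \<le> 0.2" using log_silver_ratio_bounds(2) by simp
  have count: "real N \<le> (2 * real (?c N)) ^ 4" if "4 \<le> N" for N
    using le_card_I_tree_power4[OF that]
    by (metis of_nat_le_iff of_nat_mult of_nat_numeral of_nat_power)
  then have pos: "0 < ?c N" if "4 \<le> N" for N
    using that by (intro gr0I) fastforce
  show "\<bar>?\<alpha> - 0.1966\<bar> < 0.00005"
    using log_silver_ratio_bounds by (simp add: abs_less_iff)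
  \<comment> \<open>The constant 2 in the count costs \<open>ln 2 / ln N\<close> in the exponent. From \<open>N = 2^20\<close> on this is at
    most \<open>1/20\<close>, so that \<open>1/4 - 1/20 = 0.2\<close> remains, which is still above the constant.\<close>
  have "?\<alpha> \<le> ln (real (?c N)) / ln (real N)" if N: "2 ^ 20 \<le> N" for N
  proof -
    have "4 \<le> N" using N by simp
    have "ln (real N) \<le> ln ((2 * real (?c N)) ^ 4)"
      using count[OF \<open>4 \<le> N\<close>] \<open>4 \<le> N\<close> by (intro ln_mono) auto
    also have "\<dots> = 4 * ln (2 * real (?c N))"
      using pos[OF \<open>4 \<le> N\<close>] by (subst ln_realpow) auto
    also have "ln (2 * real (?c N)) = ln 2 + ln (real (?c N))"
      using pos[OF \<open>4 \<le> N\<close>] by (intro ln_mult_pos) auto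
    finally have upper: "ln (real N) \<le> 4 * (ln 2 + ln (real (?c N)))" .
    have "20 * ln 2 = ln (2 ^ 20 :: real)" by (subst ln_realpow) simp_all
    also have "\<dots> \<le> ln (real N)"
      using N by (intro ln_mono) (auto simp flip: of_nat_le_iff)
    finally have lower: "20 * ln 2 \<le> ln (real N)" .
    have "0 < ln (real N)" using \<open>4 \<le> N\<close> by simp
    moreover have "0.2 * ln (real N) \<le> ln (real (?c N))" using upper lower by simp
    ultimately have "0.2 \<le> ln (real (?c N)) / ln (real N)" by (simp add: le_divide_eq)
    with \<alpha> show ?thesis by linarith
  qed
  then show "ereal ?\<alpha> \<le> lower_growth_exponent I_tree"
    unfolding lower_growth_exponent_def
    by (intro Liminf_bounded eventually_sequentiallyI[of "2 ^ 20"]) simp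
  have "real N powr ?\<alpha> \<le> 2 * real (?c N)" if N: "4 \<le> N" for N
  proof -
    have "real N powr ?\<alpha> \<le> real N powr (1 / 4)"
      using N \<alpha> by (intro powr_mono) auto
    also have "\<dots> \<le> ((2 * real (?c N)) ^ 4) powr (1 / 4)"
      using count[OF N] by (intro powr_mono2) auto
    also have "\<dots> = ((2 * real (?c N)) powr 4) powr (1 / 4)"
      using pos[OF N] by simp
    also have "\<dots> = 2 * real (?c N)"
      by (simp only: powr_powr) simp
    finally show ?thesis .
  qed
  then show "\<exists>\<epsilon> :: nat \<Rightarrow> real. \<epsilon> \<longlonglongrightarrow> 0 \<and>
      (\<exists>C > 0. eventually (\<lambda>N. real N powr (?\<alpha> - \<epsilon> N) \<le> C * real (?c N)) sequentially)"
    by (intro exI[of _ "\<lambda>_. 0"] conjI exI[of _ 2] eventually_sequentiallyI[of 4]) auto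
qed

end
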